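(* Let $\gamma=\{\gamma_n\}_{n=0}^\infty$ be a sequence of positive real numbers. Then $\gamma$ is a tropical index preserver if and only if $\gamma$ is log-concave.
   Context: For a sequence $\gamma=\{\gamma_n\}_{n=0}^\infty$ of real numbers, $T_\gamma\colon\mathbb{R}[z]\to\mathbb{R}[z]$ denotes the linear operator with $T_\gamma[z^n]=\gamma_n z^n$ for all $n\ge 0$. Standing convention: the polynomials $f(z)=\sum_{n=0}^d a_n z^n$ considered have coefficients $a_n\ge 0$ (the notions below depend only on $|a_n|$). Coefficients $a_n$ with $n>d$ are $0$, and $z^0=1$ also for $z=0$. A non-negative integer $m$ is a tropical index of $f(z)=\sum_n a_n z^n$ if there exists a real number $z_m\ge 0$ such that $|a_m| z_m^m \ge \max_{n\ne m} |a_n| z_m^n$. The sequence $\gamma$ is a tropical index preserver if for each polynomial $f$ the set of tropical indices of $f$ is a subset of the set of tropical indices of $T_\gamma[f]$. A positive sequence $\gamma$ is log-concave if $\gamma_n^2\ge\gamma_{n-1}\gamma_{n+1}$ for all $n\ge 1$. *)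

theory Defs
  imports Complex_Main "HOL-Computational_Algebra.Polynomial"
begin

definition diag_op :: "(nat \<Rightarrow> real) \<Rightarrow> real poly \<Rightarrow> real poly" where
  "diag_op \<gamma> f = (\<Sum>n\<le>degree f. monom (\<gamma> n * coeff f n) n)"

lemma coeff_diag_op [simp]: "coeff (diag_op \<gamma> f) n = \<gamma> n * coeff f n"
  by (cases "n \<le> degree f") (auto simp: diag_op_def coeff_sum coeff_eq_0)

lemma diag_op_add: "diag_op \<gamma> (f + g) = diag_op \<gamma> f + diag_op \<gamma> g"
  by (simp add: poly_eq_iff algebra_simps)

lemma diag_op_smult: "diag_op \<gamma> (smult c f) = smult c (diag_op \<gamma> f)"
  by (simp add: poly_eq_iff)

lemma diag_op_monom: "diag_op \<gamma> (monom 1 n) = smult (\<gamma> n) (monom 1 n)"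
  by (simp add: poly_eq_iff)

text \<open>
  The maximum is over all \<open>n \<noteq> m\<close>, including those above the degree. The set of values
  is finite because the coefficients above the degree vanish (\<open>finite_tropical_values\<close>
  below). At \<open>z = 0\<close> the convention \<open>0 ^ 0 = 1\<close> applies.
\<close>

definition tropical_index :: "real poly \<Rightarrow> nat \<Rightarrow> bool" where
  "tropical_index f m \<longleftrightarrow>
     (\<exists>z::real. z \<ge> 0 \<and>
        \<bar>coeff f m\<bar> * z ^ m \<ge> Max ((\<lambda>n. \<bar>coeff f n\<bar> * z ^ n) ` {n. n \<noteq> m}))"

lemma finite_tropical_values:
  fixes f :: "real poly" and z :: real
  shows "finite ((\<lambda>n. \<bar>coeff f n\<bar> * z ^ n) ` A)"
proof (rule finite_subset)
  show "(\<lambda>n. \<bar>coeff f n\<bar> * z ^ n) ` A \<subseteq>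
      insert 0 ((\<lambda>n. \<bar>coeff f n\<bar> * z ^ n) ` {..degree f})"
  proof
    fix x assume "x \<in> (\<lambda>n. \<bar>coeff f n\<bar> * z ^ n) ` A"
    then obtain n where "x = \<bar>coeff f n\<bar> * z ^ n" by blast
    then show "x \<in> insert 0 ((\<lambda>n. \<bar>coeff f n\<bar> * z ^ n) ` {..degree f})"
      by (cases "n \<le> degree f") (auto simp: coeff_eq_0)
  qed
qed simp

lemma tropical_index_iff:
  "tropical_index f m \<longleftrightarrow>
     (\<exists>z\<ge>0. \<forall>n. n \<noteq> m \<longrightarrow> \<bar>coeff f n\<bar> * z ^ n \<le> \<bar>coeff f m\<bar> * z ^ m)"
proof -
  have "{n. n \<noteq> m} \<noteq> {}"
    using n_not_Suc_n[of m] by (metis (mono_tags) empty_iff mem_Collect_eq)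
  then show ?thesis
    by (simp add: tropical_index_def finite_tropical_values Max_le_iff)
qed

text \<open>
  The standing convention restricts to non-negative coefficients. For positive \<open>\<gamma>\<close> this
  loses nothing, since tropical indices depend only on the absolute values of the
  coefficients.
\<close>

definition tropical_index_preserver :: "(nat \<Rightarrow> real) \<Rightarrow> bool" where
  "tropical_index_preserver \<gamma> \<longleftrightarrow>
     (\<forall>f::real poly. (\<forall>n. coeff f n \<ge> 0) \<longrightarrow>
        {m. tropical_index f m} \<subseteq> {m. tropical_index (diag_op \<gamma> f) m})"

definition log_concave :: "(nat \<Rightarrow> real) \<Rightarrow> bool" where
  "log_concave \<gamma> \<longleftrightarrow> (\<forall>n\<ge>1. (\<gamma> n)\<^sup>2 \<ge> \<gamma> (n - 1) * \<gamma> (n + 1))"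

end

theory Submission
  imports Defs
begin

text \<open>
  Log-concavity means that the ratios \<open>\<gamma> (k + 1) / \<gamma> k\<close> decrease. With \<open>r\<close> the ratio at \<open>m\<close>,
  the sequence \<open>\<gamma> n / r ^ n\<close> is therefore maximal at \<open>n = m\<close>, so if \<open>z\<close> witnesses that
  \<open>m\<close> is a tropical index of \<open>f\<close>, then \<open>z / r\<close> is a witness for the image of \<open>f\<close>.
  Conversely, \<open>m\<close> is a tropical index of \<open>1 + z + \<dots> + z ^ (m + 1)\<close>, and the two neighbouring
  inequalities of its image multiply to log-concavity at \<open>m\<close>.
\<close>

lemma log_concave_decseq_ratio:
  assumes pos: "\<And>n. \<gamma> n > 0" and lc: "log_concave \<gamma>"
  shows "decseq (\<lambda>n. \<gamma> (Suc n) / \<gamma> n)"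
proof (rule decseq_SucI)
  fix n
  have "\<gamma> n * \<gamma> (Suc (Suc n)) \<le> (\<gamma> (Suc n))\<^sup>2"
    using lc[unfolded log_concave_def, rule_format, of "Suc n"] by simp
  then show "\<gamma> (Suc (Suc n)) / \<gamma> (Suc n) \<le> \<gamma> (Suc n) / \<gamma> n"
    using pos[of n] pos[of "Suc n"] by (simp add: field_simps power2_eq_square)
qed

text \<open>Consecutive ratios are at least \<open>r\<close> before \<open>m\<close> and at most
  \<open>r\<close> from \<open>m\<close> on, so dividing by \<open>r ^ n\<close> gives a sequence
  that rises up to \<open>m\<close> and falls afterwards. Equivalently, log \<gamma> lies below a
  supporting line that touches it at \<open>m\<close>.\<close>

lemma log_concave_supporting_geometric:
  fixes m n :: nat
  assumes pos: "\<And>n. \<gamma> n > 0" and lc: "log_concave \<gamma>"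
  defines "r \<equiv> \<gamma> (Suc m) / \<gamma> m"
  shows "\<gamma> n / r ^ n \<le> \<gamma> m / r ^ m"
proof -
  have r: "r > 0"
    using pos by (simp add: r_def)
  note ratio = decseqD[OF log_concave_decseq_ratio[OF pos lc]]
  show ?thesis
  proof (cases "m \<le> n")
    case True
    then show ?thesis
    proof (induction rule: dec_induct)
      case (step k)
      have "\<gamma> (Suc k) \<le> r * \<gamma> k"
        using ratio[OF step.hyps(1)] pos[of k] by (simp add: r_def[symmetric] pos_divide_le_eq)
      then have "\<gamma> (Suc k) / r ^ Suc k \<le> \<gamma> k / r ^ k"
        using r by (simp add: field_simps)
      then show ?case
        using step.IH by linarith
    qed simp
  next
    case False
    then have "n \<le> m" by simp
    then show ?thesis
    proof (induction rule: inc_induct)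
      case (step k)
      have "r * \<gamma> k \<le> \<gamma> (Suc k)"
        using ratio[of k m] step.hyps pos[of k] by (simp add: r_def[symmetric] pos_le_divide_eq)
      then have "\<gamma> k / r ^ k \<le> \<gamma> (Suc k) / r ^ Suc k"
        using r by (simp add: field_simps)
      then show ?case
        using step.IH by linarith
    qed simp
  qed
qed

lemma log_concave_imp_tropical_index_preserver:
  assumes pos: "\<And>n. \<gamma> n > 0" and lc: "log_concave \<gamma>"
  shows "tropical_index_preserver \<gamma>"
  unfolding tropical_index_preserver_def
proof (intro allI impI subsetI CollectI)
  fix f :: "real poly" and m
  assume "m \<in> {m. tropical_index f m}"
  then obtain z where z: "z \<ge> 0"
    and idx: "\<And>n. n \<noteq> m \<Longrightarrow> \<bar>coeff f n\<bar> * z ^ n \<le> \<bar>coeff f m\<bar> * z ^ m"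
    by (auto simp: tropical_index_iff)
  define r where "r = \<gamma> (Suc m) / \<gamma> m"
  have r: "r > 0"
    using pos by (simp add: r_def)
  \<comment> \<open>Rescaling the witness by \<open>r\<close> splits each term of the image into two
    nonnegative factors, and each factor is largest at \<open>m\<close>.\<close>
  have val: "\<bar>coeff (diag_op \<gamma> f) n\<bar> * (z / r) ^ n = (\<gamma> n / r ^ n) * (\<bar>coeff f n\<bar> * z ^ n)" for n
    using pos[of n] by (simp add: abs_mult power_divide)
  have "\<bar>coeff (diag_op \<gamma> f) n\<bar> * (z / r) ^ n \<le> \<bar>coeff (diag_op \<gamma> f) m\<bar> * (z / r) ^ m"
    if "n \<noteq> m" for n
    unfolding val
  proof (rule mult_mono)
    show "\<gamma> n / r ^ n \<le> \<gamma> m / r ^ m"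
      unfolding r_def using pos lc by (rule log_concave_supporting_geometric)
    show "\<bar>coeff f n\<bar> * z ^ n \<le> \<bar>coeff f m\<bar> * z ^ m"
      using that by (rule idx)
    show "0 \<le> \<gamma> m / r ^ m"
      using r pos[of m] by simp
    show "0 \<le> \<bar>coeff f n\<bar> * z ^ n"
      using z by simp
  qed
  moreover have "z / r \<ge> 0"
    using z r by simp
  ultimately show "tropical_index (diag_op \<gamma> f) m"
    unfolding tropical_index_iff by blast
qed

lemma tropical_index_preserver_imp_log_concave:
  assumes pos: "\<And>n. \<gamma> n > 0" and pres: "tropical_index_preserver \<gamma>"
  shows "log_concave \<gamma>"
  unfolding log_concave_def
proof (intro allI impI)
  fix m :: nat
  assume "m \<ge> 1"
  then obtain k where m: "m = Suc k"
    by (cases m) auto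
  define f :: "real poly" where "f = (\<Sum>i\<le>Suc m. monom 1 i)"
  have f: "coeff f n = (if n \<le> Suc m then 1 else 0)" for n
    by (simp add: f_def coeff_sum)
  have "tropical_index f m"
    \<comment> \<open>At z = 1 all nonzero terms of \<open>f\<close> are equal, so none exceeds the
      one at \<open>m\<close>.\<close>
    unfolding tropical_index_iff by (rule exI[of _ 1]) (simp add: f)
  moreover have "\<forall>n. coeff f n \<ge> 0"
    by (simp add: f)
  ultimately have "tropical_index (diag_op \<gamma> f) m"
    using pres unfolding tropical_index_preserver_def by blast
  then obtain w where w: "w \<ge> 0" and idx: "\<And>n. n \<noteq> m \<Longrightarrow>
      \<bar>coeff (diag_op \<gamma> f) n\<bar> * w ^ n \<le> \<bar>coeff (diag_op \<gamma> f) m\<bar> * w ^ m"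
    by (auto simp: tropical_index_iff)
  \<comment> \<open>This is why \<open>f\<close> has all lower terms: without a constant term, \<open>w = 0\<close> would be a
    witness for every index.\<close>
  have "w \<noteq> 0"
    using idx[of 0] pos[of 0] by (auto simp: f m)
  with w have w: "w > 0" by simp
  \<comment> \<open>Cancelling \<open>w ^ k\<close> in the comparison with \<open>k\<close>, and
    \<open>w ^ m\<close> in the one with \<open>Suc m\<close>, bounds \<open>w\<close> from below by
    \<open>\<gamma> k / \<gamma> m\<close> and from above by
    \<open>\<gamma> m / \<gamma> (Suc m)\<close>.\<close>
  have "\<gamma> k \<le> \<gamma> m * w"
    using idx[of k] pos[of k] pos[of m] w by (simp add: f m)
  moreover have "\<gamma> (Suc m) * w \<le> \<gamma> m"
    using idx[of "Suc m"] pos[of "Suc m"] pos[of m] w by (simp add: f m field_simps)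
  ultimately have "\<gamma> k * (\<gamma> (Suc m) * w) \<le> (\<gamma> m * w) * \<gamma> m"
    using pos w by (intro mult_mono) (auto simp: less_imp_le)
  then have "(\<gamma> k * \<gamma> (Suc m)) * w \<le> (\<gamma> m)\<^sup>2 * w"
    by (simp add: power2_eq_square mult_ac)
  then show "(\<gamma> m)\<^sup>2 \<ge> \<gamma> (m - 1) * \<gamma> (m + 1)"
    using w by (simp add: m)
qed

theorem theorem1:
  fixes \<gamma> :: "nat \<Rightarrow> real"
  assumes "\<And>n. \<gamma> n > 0"
  shows "tropical_index_preserver \<gamma> \<longleftrightarrow> log_concave \<gamma>"
  using assms log_concave_imp_tropical_index_preserver tropical_index_preserver_imp_log_concave
  by blast

end
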